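(* Let $\mathbb F$ be a field of characteristic $p\ge3$ and let $\mathcal H$ be the Heisenberg Lie algebra over $\mathbb F$ with basis $x,y,z$ and bracket $[x,y]=z$, $z$ central. There are three non-isomorphic restricted Heisenberg algebras $(\mathcal H,\theta)$, respectively given by the linear forms $\theta=0$, $\theta=x^*$ and $\theta=z^*$.
   Context: Restricted Lie algebra over a field $\mathbb F$ of characteristic $p$: a Lie algebra $L$ with a map $(\cdot)^{[p]}:L\to L$ (the $p$-map) such that $(\lambda x)^{[p]}=\lambda^p x^{[p]}$; $[x,y^{[p]}]=[[\cdots[x,y],y],\cdots,y]$ ($p$ copies of $y$); $(x+y)^{[p]}=x^{[p]}+y^{[p]}+\sum_{i=1}^{p-1}s_i(x,y)$, where $i\,s_i(x,y)$ is the coefficient of $Z^{i-1}$ in $\mathrm{ad}^{p-1}_{Zx+y}(x)$. An isomorphism of restricted Lie algebras is a Lie isomorphism commuting with the $p$-maps. For a linear form $\theta:\mathcal H\to\mathbb F$, the restricted Heisenberg algebra $(\mathcal H,\theta)$ is $\mathcal H$ with the $p$-map determined by $x^{[p]}=\theta(x)z$, $y^{[p]}=\theta(y)z$, $z^{[p]}=\theta(z)z$, i.e. $(\alpha x+\beta y+\gamma z)^{[p]}=(\alpha^p\theta(x)+\beta^p\theta(y)+\gamma^p\theta(z))z$; every $p$-map on $\mathcal H$ is of this form. $x^*,y^*,z^*$ is the dual basis of $x,y,z$.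
   Formalization: That the three algebras are the only ones up to isomorphism is stated only for algebraically closed fields, since it fails over F_p (θ = 2z* is isomorphic to none of them); that they are restricted and pairwise non-isomorphic is stated over every field of characteristic p ≥ 3. *)

theory Defs
  imports "HOL-Analysis.Analysis" "HOL-Computational_Algebra.Computational_Algebra"
begin

section \<open>Restricted Lie algebras\<close>

locale lie_algebra = vector_space scale
  for scale :: "'k::field \<Rightarrow> 'v::ab_group_add \<Rightarrow> 'v" +
  fixes bracket :: "'v \<Rightarrow> 'v \<Rightarrow> 'v"
  assumes bracket_add_left: "bracket (u + v) w = bracket u w + bracket v w"
    and bracket_add_right: "bracket u (v + w) = bracket u v + bracket u w"
    and bracket_scale_left: "bracket (scale c u) v = scale c (bracket u v)"
    and bracket_scale_right: "bracket u (scale c v) = scale c (bracket u v)"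
    and bracket_self: "bracket u u = 0"
    and jacobi: "bracket u (bracket v w) + bracket v (bracket w u) + bracket w (bracket u v) = 0"

text \<open>
  The Lie algebra obtained from \<open>L\<close> by extending scalars to polynomials in an indeterminate
  \<open>Z\<close> is represented by the polynomials \<open>\<Sum>i. v\<^sub>i Z^i\<close> with coefficients \<open>v\<^sub>i\<close> in \<open>L\<close>, that is by
  the type \<open>'v poly\<close>. The following is the bilinear extension of the bracket,
  \<open>[u Z^i, v Z^j] = [u, v] Z^(i + j)\<close>.
\<close>

definition poly_bracket ::
    "('v \<Rightarrow> 'v \<Rightarrow> 'v) \<Rightarrow> 'v::ab_group_add poly \<Rightarrow> 'v poly \<Rightarrow> 'v poly" where
  "poly_bracket br P Q =
     (\<Sum>i\<le>degree P. \<Sum>j\<le>degree Q. monom (br (coeff P i) (coeff Q j)) (i + j))"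

text \<open>
  \<open>jacobson_s sc br i u v\<close> is the element \<open>s\<^sub>i(u, v)\<close> such that \<open>i s\<^sub>i(u, v)\<close> is the coefficient
  of \<open>Z^(i - 1)\<close> in \<open>ad(Z u + v)^(p - 1) (u)\<close>, where \<open>p\<close> is the characteristic. It is only used
  for \<open>1 \<le> i < p\<close>, where \<open>i\<close> is invertible in the field. The polynomial \<open>Z u + v\<close> is \<open>[:v, u:]\<close>,
  with the constant coefficient first.
\<close>

definition jacobson_s ::
    "('k::field \<Rightarrow> 'v::ab_group_add \<Rightarrow> 'v) \<Rightarrow> ('v \<Rightarrow> 'v \<Rightarrow> 'v) \<Rightarrow> nat \<Rightarrow> 'v \<Rightarrow> 'v \<Rightarrow> 'v" where
  "jacobson_s sc br i u v =
     sc (inverse (of_nat i))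
       (coeff ((poly_bracket br [:v, u:] ^^ (CHAR('k) - 1)) [:u:]) (i - 1))"

locale restricted_lie_algebra = lie_algebra scale bracket
  for scale :: "'k::field \<Rightarrow> 'v::ab_group_add \<Rightarrow> 'v"
    and bracket :: "'v \<Rightarrow> 'v \<Rightarrow> 'v" +
  fixes pmap :: "'v \<Rightarrow> 'v"
  assumes char_pos: "CHAR('k) > 0"
    and pmap_scale: "pmap (scale c u) = scale (c ^ CHAR('k)) (pmap u)"
    and bracket_pmap: "bracket u (pmap v) = ((\<lambda>w. bracket w v) ^^ CHAR('k)) u"
    and pmap_add: "pmap (u + v) =
      pmap u + pmap v + (\<Sum>i = 1..CHAR('k) - 1. jacobson_s scale bracket i u v)"

definition restricted_lie_iso ::
    "('k::field \<Rightarrow> 'v::ab_group_add \<Rightarrow> 'v) \<Rightarrow> ('v \<Rightarrow> 'v \<Rightarrow> 'v) \<Rightarrow> ('v \<Rightarrow> 'v) \<Rightarrow>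
     ('k \<Rightarrow> 'w::ab_group_add \<Rightarrow> 'w) \<Rightarrow> ('w \<Rightarrow> 'w \<Rightarrow> 'w) \<Rightarrow> ('w \<Rightarrow> 'w) \<Rightarrow>
     ('v \<Rightarrow> 'w) \<Rightarrow> bool" where
  "restricted_lie_iso scale1 br1 pmap1 scale2 br2 pmap2 f \<longleftrightarrow>
     Vector_Spaces.linear scale1 scale2 f \<and> bij f \<and>
     (\<forall>u v. f (br1 u v) = br2 (f u) (f v)) \<and>
     (\<forall>u. f (pmap1 u) = pmap2 (f u))"

section \<open>Restricted Heisenberg algebras\<close>

text \<open>
  The Heisenberg algebra over \<open>'a\<close> is \<open>'a ^ 3\<close>, with the standard basis as the basis \<open>x, y, z\<close>.
\<close>

definition hx :: "'a::field ^ 3" where "hx = axis 1 1"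
definition hy :: "'a::field ^ 3" where "hy = axis 2 1"
definition hz :: "'a::field ^ 3" where "hz = axis 3 1"

definition heis_bracket :: "'a::field ^ 3 \<Rightarrow> 'a ^ 3 \<Rightarrow> 'a ^ 3" where
  "heis_bracket u v = (u $ 1 * v $ 2 - u $ 2 * v $ 1) *s hz"

lemma heis_bracket_basis:
  "heis_bracket hx hy = (hz :: 'a::field ^ 3)"
  "heis_bracket hx hz = (0 :: 'a::field ^ 3)"
  "heis_bracket hy hz = (0 :: 'a::field ^ 3)"
  by (auto simp: heis_bracket_def hx_def hy_def hz_def axis_def vec_eq_iff)

definition dual_x :: "'a::field ^ 3 \<Rightarrow> 'a" where "dual_x v = v $ 1"
definition dual_z :: "'a::field ^ 3 \<Rightarrow> 'a" where "dual_z v = v $ 3"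

abbreviation linear_form :: "('a::field ^ 3 \<Rightarrow> 'a) \<Rightarrow> bool" where
  "linear_form \<equiv> Vector_Spaces.linear (*s) (*)"

definition heis_pmap :: "('a::field ^ 3 \<Rightarrow> 'a) \<Rightarrow> 'a ^ 3 \<Rightarrow> 'a ^ 3" where
  "heis_pmap \<theta> v =
     ((v $ 1) ^ CHAR('a) * \<theta> hx + (v $ 2) ^ CHAR('a) * \<theta> hy + (v $ 3) ^ CHAR('a) * \<theta> hz) *s hz"

definition restricted_heisenberg :: "('a::field ^ 3 \<Rightarrow> 'a) \<Rightarrow> bool" where
  "restricted_heisenberg \<theta> \<longleftrightarrow>
     linear_form \<theta> \<and> restricted_lie_algebra (*s) heis_bracket (heis_pmap \<theta>)"

definition heis_isomorphic :: "('a::field ^ 3 \<Rightarrow> 'a) \<Rightarrow> ('a ^ 3 \<Rightarrow> 'a) \<Rightarrow> bool" where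
  "heis_isomorphic \<theta> \<theta>' \<longleftrightarrow>
     (\<exists>f. restricted_lie_iso (*s) heis_bracket (heis_pmap \<theta>) (*s) heis_bracket (heis_pmap \<theta>') f)"

text \<open>
  This is the property of the class \<open>alg_closed_field\<close>, as a predicate on the types of class
  \<open>field\<close>, so that it can be a hypothesis on part of a conclusion.
\<close>

definition algebraically_closed :: "'a::field itself \<Rightarrow> bool" where
  "algebraically_closed _ \<longleftrightarrow> (\<forall>q :: 'a poly. degree q > 0 \<longrightarrow> (\<exists>c. poly q c = 0))"

end

theory Submission
  imports Defs
begin

text \<open>
  Every bracket is a multiple of the central element \<open>z\<close>, so two nested brackets vanish; as
  \<open>p - 1 \<ge> 2\<close>, the Jacobson terms vanish, and every \<open>\<theta>\<close> gives a restricted structure. For an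
  isomorphism \<open>f\<close>, \<open>f z\<close> is a nonzero multiple of \<open>z\<close>; hence vanishing of the \<open>p\<close>-map, and vanishing
  of \<open>z\<^sup>[\<^sup>p\<^sup>]\<close>, are invariants, which separate the three algebras. Over an algebraically
  closed field, the coefficients of a linear map that fixes the line of \<open>z\<close> and carries \<open>\<theta>\<close> to
  its normal form are roots of equations \<open>X\<^sup>p = a\<close> and \<open>X\<^sup>p\<^sup>-\<^sup>1 = a\<close>.
\<close>

section \<open>Coordinates and nilpotency of the bracket\<close>

lemma heis_bracket_nth:
  fixes u v :: "'a::field ^ 3"
  shows
  "heis_bracket u v $ 1 = 0" "heis_bracket u v $ 2 = 0"
  "heis_bracket u v $ 3 = u $ 1 * v $ 2 - u $ 2 * v $ 1"
  by (auto simp: heis_bracket_def hz_def axis_def)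

lemma heis_pmap_nth:
  fixes v :: "'a::field ^ 3"
  shows "heis_pmap \<theta> v $ 1 = 0" "heis_pmap \<theta> v $ 2 = 0"
  "heis_pmap \<theta> v $ 3 =
     (v $ 1) ^ CHAR('a) * \<theta> hx + (v $ 2) ^ CHAR('a) * \<theta> hy + (v $ 3) ^ CHAR('a) * \<theta> hz"
  by (auto simp: heis_pmap_def hz_def axis_def)

lemma heis_basis_nth:
  "hx $ 1 = 1" "hx $ 2 = 0" "hx $ 3 = 0"
  "hy $ 1 = 0" "hy $ 2 = 1" "hy $ 3 = 0"
  "hz $ 1 = 0" "hz $ 2 = 0" "hz $ 3 = 1"
  by (auto simp: hx_def hy_def hz_def axis_def)

lemma vec3_eq_iff:
  fixes u v :: "'a ^ 3"
  shows "u = v \<longleftrightarrow> u $ 1 = v $ 1 \<and> u $ 2 = v $ 2 \<and> u $ 3 = v $ 3"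
  by (simp add: vec_eq_iff forall_3)

lemma heis_bracket_central:
  fixes u v :: "'a::field ^ 3"
  assumes "v $ 1 = 0" "v $ 2 = 0"
  shows "heis_bracket u v = 0" "heis_bracket v u = 0"
  using assms by (auto simp: vec3_eq_iff heis_bracket_nth)

lemma lie_algebra_heis: "lie_algebra (*s) (heis_bracket :: 'a::field ^ 3 \<Rightarrow> _)"
  by unfold_locales (auto simp: vec3_eq_iff heis_bracket_nth algebra_simps)

lemma coeff_poly_bracket_heis_nth:
  fixes P Q :: "('a::field ^ 3) poly"
  assumes "k = 1 \<or> k = 2"
  shows "coeff (poly_bracket heis_bracket P Q) n $ k = 0"
  using assms
  by (auto simp: poly_bracket_def coeff_sum sum_component heis_bracket_nth intro!: sum.neutral)

lemma poly_bracket_heis_central: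
  fixes P Q :: "('a::field ^ 3) poly"
  assumes "\<And>n. coeff Q n $ 1 = 0" "\<And>n. coeff Q n $ 2 = 0"
  shows "poly_bracket heis_bracket P Q = 0"
  using assms by (simp add: poly_bracket_def heis_bracket_central)

text \<open>The first bracket moves every coefficient onto the line of \<open>hz\<close>, and the
  second one kills it.\<close>

lemma poly_bracket_heis_funpow:
  fixes P Q :: "('a::field ^ 3) poly"
  shows "(poly_bracket heis_bracket P ^^ Suc (Suc n)) Q = 0"
  by (induction n) (simp_all add: poly_bracket_heis_central coeff_poly_bracket_heis_nth)

lemma heis_bracket_funpow:
  fixes u v :: "'a::field ^ 3"
  shows "((\<lambda>w. heis_bracket w v) ^^ Suc (Suc n)) u = 0"
  by (induction n) (simp_all add: heis_bracket_central heis_bracket_nth)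

lemma jacobson_s_heis:
  fixes u v :: "'a::field ^ 3"
  assumes "CHAR('a) \<ge> 3"
  shows "jacobson_s (*s) heis_bracket i u v = 0"
proof -
  \<comment> \<open>Here \<open>p \<ge> 3\<close> enters: at least two brackets are applied. For
    \<open>p = 2\<close> a single one would remain, leaving \<open>[v, u]\<close>.\<close>
  obtain n where n: "CHAR('a) - 1 = Suc (Suc n)"
    using assms by (metis add_2_eq_Suc diff_le_mono le_Suc_ex numeral_3_eq_3 diff_Suc_1 numeral_2_eq_2)
  show ?thesis
    unfolding jacobson_s_def n poly_bracket_heis_funpow by simp
qed

section \<open>Restricted structures from linear forms\<close>

lemma restricted_heisenbergI:
  fixes \<theta> :: "'a::field ^ 3 \<Rightarrow> 'a"
  assumes p: "CHAR('a) \<ge> 3" and \<theta>: "linear_form \<theta>"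
  shows "restricted_heisenberg \<theta>"
proof -
  interpret lie_algebra "(*s)" "heis_bracket :: 'a ^ 3 \<Rightarrow> _"
    by (rule lie_algebra_heis)
  have prime: "prime CHAR('a)"
    using p by (intro prime_CHAR_semidom) simp
  obtain n where n: "CHAR('a) = Suc (Suc n)"
    using p by (metis add_2_eq_Suc le_Suc_ex numeral_3_eq_3 add_Suc numeral_2_eq_2)
  have "restricted_lie_algebra (*s) heis_bracket (heis_pmap \<theta>)"
  proof
    show "CHAR('a) > 0" using p by simp
    show "heis_pmap \<theta> (c *s u) = c ^ CHAR('a) *s heis_pmap \<theta> u" for c u
      by (simp add: vec3_eq_iff heis_pmap_nth power_mult_distrib algebra_simps)
    \<comment> \<open>Both sides vanish: the values of the p-map are central, and the right side
      nests at least two brackets.\<close>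
    show "heis_bracket u (heis_pmap \<theta> v) = ((\<lambda>w. heis_bracket w v) ^^ CHAR('a)) u" for u v
      unfolding n heis_bracket_funpow by (simp add: heis_bracket_central heis_pmap_nth)
    \<comment> \<open>Without the Jacobson terms, this is additivity of the Frobenius map in each
      coordinate.\<close>
    show "heis_pmap \<theta> (u + v) = heis_pmap \<theta> u + heis_pmap \<theta> v
        + (\<Sum>i = 1..CHAR('a) - 1. jacobson_s (*s) heis_bracket i u v)" for u v
      by (simp add: jacobson_s_heis[OF p] vec3_eq_iff heis_pmap_nth
          freshmans_dream[OF prime refl] algebra_simps)
  qed
  with \<theta> show ?thesis by (simp add: restricted_heisenberg_def)
qed

lemma linear_forms:
  "linear_form (\<lambda>_. 0)" "linear_form dual_x" "linear_form dual_z"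
  by (unfold_locales; simp add: dual_x_def dual_z_def algebra_simps)+

section \<open>Isomorphism invariants\<close>

lemma heis_pmap_eq_0_if_isomorphic_zero:
  fixes \<theta> :: "'a::field ^ 3 \<Rightarrow> 'a"
  assumes "heis_isomorphic (\<lambda>_. 0) \<theta>"
  shows "heis_pmap \<theta> v = 0"
proof -
  obtain f where f: "Vector_Spaces.linear (*s) (*s) f" "bij f"
    "\<And>u. f (heis_pmap (\<lambda>_. 0) u) = heis_pmap \<theta> (f u)"
    using assms by (auto simp: heis_isomorphic_def restricted_lie_iso_def)
  obtain u where u: "v = f u" using \<open>bij f\<close> by (metis bij_pointE)
  have "heis_pmap (\<lambda>_. 0) u = 0" by (simp add: heis_pmap_def)
  then show ?thesis
    using f(3)[of u] vec.linear_0[OF f(1)] u by simp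
qed

text \<open>If \<open>f hz = c *s hz\<close> with \<open>c \<noteq> 0\<close>, then the p-map of
  \<theta>' sends \<open>f hz\<close> to \<open>(c ^ p * \<theta>' hz) *s hz\<close>, which must be
  the image of 0.\<close>

lemma heis_isomorphic_form_hz_eq_0:
  fixes \<theta> \<theta>' :: "'a::field ^ 3 \<Rightarrow> 'a"
  assumes "CHAR('a) > 0" and "heis_isomorphic \<theta> \<theta>'" and "\<theta> hz = 0"
  shows "\<theta>' hz = 0"
proof -
  obtain f where f: "Vector_Spaces.linear (*s) (*s) f" "bij f"
    "\<And>u v. f (heis_bracket u v) = heis_bracket (f u) (f v)"
    "\<And>u. f (heis_pmap \<theta> u) = heis_pmap \<theta>' (f u)"
    using assms by (auto simp: heis_isomorphic_def restricted_lie_iso_def)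
  have f0: "f 0 = 0" by (rule vec.linear_0[OF f(1)])
  \<comment> \<open>As \<open>hz\<close> is the bracket of \<open>hx\<close> and \<open>hy\<close>,
    its image is again a bracket.\<close>
  have z: "f hz $ 1 = 0" "f hz $ 2 = 0"
    using f(3)[of hx hy] by (simp_all add: heis_bracket_basis heis_bracket_nth)
  have "f hz \<noteq> 0"
    using f0 \<open>bij f\<close> by (metis bij_pointE heis_basis_nth(9) zero_index zero_neq_one)
  with z have nz: "f hz $ 3 \<noteq> 0" by (simp add: vec3_eq_iff)
  have "heis_pmap \<theta> hz = 0"
    using assms by (simp add: vec3_eq_iff heis_pmap_nth heis_basis_nth zero_power)
  then have "heis_pmap \<theta>' (f hz) $ 3 = 0"
    using f(4)[of hz] f0 by simp
  with z nz \<open>CHAR('a) > 0\<close> show ?thesis by (simp add: heis_pmap_nth zero_power)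
qed

section \<open>Isomorphisms onto the normal forms\<close>

text \<open>The map has columns \<open>(a1, a2, a3)\<close>, \<open>(b1, b2, b3)\<close>,
  \<open>(0, 0, t)\<close>. Preserving the bracket of \<open>hx\<close> and \<open>hy\<close> forces
  \<open>t\<close> to be the upper left 2 by 2 determinant. Values of the p-maps lie on the line of
  \<open>hz\<close>, which is scaled by \<open>t\<close>, so comparing third coordinates
  suffices.\<close>

lemma heis_isomorphicI:
  fixes \<theta> \<theta>' :: "'a::field ^ 3 \<Rightarrow> 'a"
  assumes t: "t = a1 * b2 - b1 * a2" "t \<noteq> 0"
    and pmap: "\<And>u :: 'a ^ 3. t * heis_pmap \<theta> u $ 3 = heis_pmap \<theta>'
      (vector [a1 * u $ 1 + b1 * u $ 2, a2 * u $ 1 + b2 * u $ 2,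
               a3 * u $ 1 + b3 * u $ 2 + t * u $ 3]) $ 3"
  shows "heis_isomorphic \<theta> \<theta>'"
proof -
  define f :: "'a ^ 3 \<Rightarrow> 'a ^ 3" where
    "f u = vector [a1 * u $ 1 + b1 * u $ 2, a2 * u $ 1 + b2 * u $ 2,
                   a3 * u $ 1 + b3 * u $ 2 + t * u $ 3]" for u
  have lin: "Vector_Spaces.linear (*s) (*s) f"
    by unfold_locales (simp_all add: f_def vec3_eq_iff algebra_simps)
  have "u = 0" if "f u = 0" for u
  proof -
    have e: "a1 * u $ 1 + b1 * u $ 2 = 0" "a2 * u $ 1 + b2 * u $ 2 = 0"
      "a3 * u $ 1 + b3 * u $ 2 + t * u $ 3 = 0"
      using that by (simp_all add: f_def vec3_eq_iff)
    \<comment> \<open>Cramer's rule for the first two equations.\<close>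
    have "t * u $ 1 = b2 * (a1 * u $ 1 + b1 * u $ 2) - b1 * (a2 * u $ 1 + b2 * u $ 2)"
      "t * u $ 2 = a1 * (a2 * u $ 1 + b2 * u $ 2) - a2 * (a1 * u $ 1 + b1 * u $ 2)"
      by (simp_all add: t(1) algebra_simps)
    then have "u $ 1 = 0" "u $ 2 = 0"
      unfolding e using t(2) by simp_all
    with e(3) t(2) show ?thesis by (simp add: vec3_eq_iff)
  qed
  then have "inj f"
    using vec.linear_inj_iff_eq_0[OF lin] by blast
  then have "bij f"
    using vec.linear_inj_imp_surj[OF lin] by (simp add: bij_def)
  moreover have "f (heis_bracket u v) = heis_bracket (f u) (f v)" for u v
    by (simp add: f_def vec3_eq_iff heis_bracket_nth t(1) algebra_simps)
  moreover have "f (heis_pmap \<theta> u) = heis_pmap \<theta>' (f u)" for u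
    using pmap[of u] by (simp add: vec3_eq_iff heis_pmap_nth(1,2) f_def)
  ultimately show ?thesis
    using lin unfolding heis_isomorphic_def restricted_lie_iso_def by blast
qed

lemma algebraically_closed_nth_root:
  fixes a :: "'a::field"
  assumes "algebraically_closed TYPE('a)" "n > 0"
  obtains c where "c ^ n = a"
proof -
  have "degree (monom 1 n + [:- a:]) = n"
    using assms(2) by (subst degree_add_eq_left) (simp_all add: degree_monom_eq)
  then obtain c where "poly (monom 1 n + [:- a:]) c = 0"
    using assms unfolding algebraically_closed_def by metis
  then show thesis by (intro that[of c]) (simp add: poly_monom)
qed

lemma heis_isomorphic_dual_z:
  fixes \<theta> :: "'a::field ^ 3 \<Rightarrow> 'a"
  assumes p: "CHAR('a) \<ge> 3" and ac: "algebraically_closed TYPE('a)" and nz: "\<theta> hz \<noteq> 0"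
  shows "heis_isomorphic \<theta> dual_z"
proof -
  have prime: "prime CHAR('a)"
    using p by (intro prime_CHAR_semidom) simp
  \<comment> \<open>The third coordinate of the image is to be \<open>a u1 + b u2 + t u3\<close>,
    and its p-th power must equal \<open>t\<close> times the p-map of \<theta>. Comparing
    coefficients gives \<open>t ^ p = t * \<theta> hz\<close> and the equations for \<open>a\<close>
    and \<open>b\<close>.\<close>
  obtain t where t: "t ^ (CHAR('a) - 1) = \<theta> hz"
    using algebraically_closed_nth_root[OF ac, of "CHAR('a) - 1"] p by auto
  have tp: "t ^ CHAR('a) = t * \<theta> hz"
    using t p by (metis One_nat_def Suc_pred gr0I not_numeral_le_zero power_Suc)
  have "t \<noteq> 0" using t nz p by (auto simp: zero_power)
  obtain a where a: "a ^ CHAR('a) = t * \<theta> hx"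
    using algebraically_closed_nth_root[OF ac, of "CHAR('a)"] p by auto
  obtain b where b: "b ^ CHAR('a) = t * \<theta> hy"
    using algebraically_closed_nth_root[OF ac, of "CHAR('a)"] p by auto
  show ?thesis
  proof (rule heis_isomorphicI)
    show "t = t * 1 - 0 * 0" by simp
    show "t * heis_pmap \<theta> u $ 3 = heis_pmap dual_z
      (vector [t * u $ 1 + 0 * u $ 2, 0 * u $ 1 + 1 * u $ 2, a * u $ 1 + b * u $ 2 + t * u $ 3]) $ 3"
      for u
      by (simp add: heis_pmap_nth dual_z_def heis_basis_nth freshmans_dream[OF prime refl]
          power_mult_distrib a b tp algebra_simps)
  qed fact
qed

lemma heis_isomorphic_dual_x:
  fixes \<theta> :: "'a::field ^ 3 \<Rightarrow> 'a"
  assumes p: "CHAR('a) \<ge> 3" and ac: "algebraically_closed TYPE('a)"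
    and z: "\<theta> hz = 0" and nz: "\<theta> hx \<noteq> 0 \<or> \<theta> hy \<noteq> 0"
  shows "heis_isomorphic \<theta> dual_x"
proof -
  have prime: "prime CHAR('a)"
    using p by (intro prime_CHAR_semidom) simp
  \<comment> \<open>With \<open>t = 1\<close>, the first coordinate \<open>a u1 + b u2\<close> of
    the image must have p-th power
    \<open>u1 ^ p * \<theta> hx + u2 ^ p * \<theta> hy\<close>.\<close>
  obtain a where a: "a ^ CHAR('a) = \<theta> hx"
    using algebraically_closed_nth_root[OF ac, of "CHAR('a)"] p by auto
  obtain b where b: "b ^ CHAR('a) = \<theta> hy"
    using algebraically_closed_nth_root[OF ac, of "CHAR('a)"] p by auto
  have "a \<noteq> 0 \<or> b \<noteq> 0"
    using nz a b p by (auto simp: zero_power)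
  \<comment> \<open>A second row \<open>(c, d)\<close> completes the nonzero row
    \<open>(a, b)\<close> to determinant 1.\<close>
  then obtain c d where cd: "1 = a * d - b * c"
  proof
    assume "a \<noteq> 0" then show thesis by (intro that[of "1 / a" 0]) simp
  next
    assume "b \<noteq> 0" then show thesis by (intro that[of 0 "- 1 / b"]) simp
  qed
  show ?thesis
  proof (rule heis_isomorphicI[OF cd])
    show "1 * heis_pmap \<theta> u $ 3 = heis_pmap dual_x
      (vector [a * u $ 1 + b * u $ 2, c * u $ 1 + d * u $ 2, 0 * u $ 1 + 0 * u $ 2 + 1 * u $ 3]) $ 3"
      for u
      by (simp add: heis_pmap_nth dual_x_def heis_basis_nth freshmans_dream[OF prime refl]
          power_mult_distrib a b z algebra_simps)
  qed simp
qed

lemma heis_isomorphic_zero: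
  fixes \<theta> :: "'a::field ^ 3 \<Rightarrow> 'a"
  assumes "\<theta> hx = 0" "\<theta> hy = 0" "\<theta> hz = 0"
  shows "heis_isomorphic \<theta> (\<lambda>_. 0)"
  \<comment> \<open>This instance is the identity matrix; both p-maps are 0.\<close>
  by (rule heis_isomorphicI[of 1 1 1 0 0 _ _ 0 0]) (simp_all add: heis_pmap_nth assms)

theorem theorem5p3:
  assumes "CHAR('a::field) \<ge> 3"
  shows "(restricted_heisenberg (\<lambda>_ :: 'a ^ 3. 0) \<and>
          restricted_heisenberg (dual_x :: 'a ^ 3 \<Rightarrow> 'a) \<and>
          restricted_heisenberg (dual_z :: 'a ^ 3 \<Rightarrow> 'a)) \<and>
         (\<not> heis_isomorphic (\<lambda>_ :: 'a ^ 3. 0) dual_x \<and>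
          \<not> heis_isomorphic (\<lambda>_ :: 'a ^ 3. 0) dual_z \<and>
          \<not> heis_isomorphic (dual_x :: 'a ^ 3 \<Rightarrow> 'a) dual_z) \<and>
         (algebraically_closed TYPE('a) \<longrightarrow>
          (\<forall>\<theta> :: 'a ^ 3 \<Rightarrow> 'a. restricted_heisenberg \<theta> \<longrightarrow>
             heis_isomorphic \<theta> (\<lambda>_. 0) \<or> heis_isomorphic \<theta> dual_x \<or> heis_isomorphic \<theta> dual_z))"
proof (intro conjI impI allI)
  show "restricted_heisenberg (\<lambda>_ :: 'a ^ 3. 0)" "restricted_heisenberg (dual_x :: 'a ^ 3 \<Rightarrow> 'a)"
    "restricted_heisenberg (dual_z :: 'a ^ 3 \<Rightarrow> 'a)"
    by (rule restricted_heisenbergI[OF assms linear_forms(1)]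
        restricted_heisenbergI[OF assms linear_forms(2)]
        restricted_heisenbergI[OF assms linear_forms(3)])+
  have "heis_pmap (dual_x :: 'a ^ 3 \<Rightarrow> 'a) hx $ 3 = 1"
    using assms by (simp add: heis_pmap_nth dual_x_def heis_basis_nth)
  then show "\<not> heis_isomorphic (\<lambda>_ :: 'a ^ 3. 0) dual_x"
    using heis_pmap_eq_0_if_isomorphic_zero by fastforce
  \<comment> \<open>Both 0 and \<open>dual_x\<close> vanish at \<open>hz\<close>, but
    \<open>dual_z\<close> does not.\<close>
  show "\<not> heis_isomorphic (\<lambda>_ :: 'a ^ 3. 0) dual_z"
    "\<not> heis_isomorphic (dual_x :: 'a ^ 3 \<Rightarrow> 'a) dual_z"
    using heis_isomorphic_form_hz_eq_0[of "\<lambda>_. 0" "dual_z :: 'a ^ 3 \<Rightarrow> 'a"]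
      heis_isomorphic_form_hz_eq_0[of dual_x "dual_z :: 'a ^ 3 \<Rightarrow> 'a"] assms
    by (auto simp: dual_x_def dual_z_def heis_basis_nth)
  \<comment> \<open>The cases are \<open>\<theta> hz \<noteq> 0\<close>, then
    \<open>\<theta> hz = 0\<close> with \<theta> nonzero at \<open>hx\<close> or \<open>hy\<close>,
    then \<theta> zero on the whole basis.\<close>
  show "heis_isomorphic \<theta> (\<lambda>_. 0) \<or> heis_isomorphic \<theta> dual_x \<or> heis_isomorphic \<theta> dual_z"
    if "algebraically_closed TYPE('a)" for \<theta> :: "'a ^ 3 \<Rightarrow> 'a"
    using heis_isomorphic_zero heis_isomorphic_dual_x[OF assms that]
      heis_isomorphic_dual_z[OF assms that] by blast
qed

end
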